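(* Let $\mathcal{N}$ be a countably infinite node set and let $\{\mathcal{P}_{\mathcal{N}'}:\mathcal{N}'\subseteq\mathcal{N}\text{ finite}\}$ be a strongly consistent family of random network models. If, for every finite $\mathcal{N}'\subseteq\mathcal{N}$, all elements of $\mathcal{P}_{\mathcal{N}'}$ are exchangeable and Markov with respect to the bidirected complement of the incidence graph, $L^c_{\leftrightarrow}(\mathcal{N}')$, then they are all Erdős–Rényi models; that is, for every finite $\mathcal{N}'$ and every $P\in\mathcal{P}_{\mathcal{N}'}$, the ties $X_{ij}$, $ij\in D(\mathcal{N}')$, are independent and identically distributed under $P$.
   Context: For a node set $\mathcal{N}'$, $D(\mathcal{N}')$ is the set of dyads (unordered pairs $ij$ of distinct nodes), and a random network on $\mathcal{N}'$ is a family $X=(X_d)_{d\in D(\mathcal{N}')}$ of $\{0,1\}$-valued random variables. It (or its distribution) is exchangeable if its distribution is invariant under all permutations of the nodes. A random network model $\mathcal{P}_{\mathcal{N}'}$ is a set of probability distributions of random networks on $\mathcal{N}'$. For $\mathcal{N}''\subseteq\mathcal{N}'$, $\Pi^{\mathcal{N}'}_{\mathcal{N}''}$ maps the distribution of $(X_d)_{d\in D(\mathcal{N}')}$ to the marginal distribution of $(X_d)_{d\in D(\mathcal{N}'')}$. The family is strongly consistent if $\mathcal{P}_{\mathcal{N}''}=\Pi^{\mathcal{N}'}_{\mathcal{N}''}(\mathcal{P}_{\mathcal{N}'})$ for all finite $\mathcal{N}''\subseteq\mathcal{N}'\subseteq\mathcal{N}$. $L^c_{\leftrightarrow}(\mathcal{N}')$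 is the bidirected graph with vertex set $D(\mathcal{N}')$ having a bidirected edge between two dyads iff they are disjoint (share no node). A distribution of $(X_v)_{v\in V}$ is Markov with respect to a bidirected graph $G$ on $V$ if, for all disjoint $A,B,S\subseteq V$ with $A,B$ nonempty ($S$ possibly empty), $X_A$ and $X_B$ are conditionally independent given $X_S$ whenever every path in $G$ between $A$ and $B$ has a vertex outside $A\cup B\cup S$. *)

theory Defs
  imports "HOL-Probability.Probability" "Graph_Theory.Graph_Theory"
begin

definition dyads :: "'a set \<Rightarrow> 'a set set" where
  "dyads N = {d. d \<subseteq> N \<and> card d = 2}"

(* A configuration (x_v), v in V, is a Boolean function that is undefined outside V,
   with True encoding the value 1.  For finite V, the distribution of a family (X_v),
   v in V, is then a pmf supported on such functions. *)
definition distribution_on :: "'v set \<Rightarrow> ('v \<Rightarrow> bool) pmf \<Rightarrow> bool" where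
  "distribution_on V P \<longleftrightarrow> set_pmf P \<subseteq> V \<rightarrow>\<^sub>E UNIV"

definition random_network_model :: "'a set \<Rightarrow> ('a set \<Rightarrow> bool) pmf set \<Rightarrow> bool" where
  "random_network_model N \<P> \<longleftrightarrow> (\<forall>P\<in>\<P>. distribution_on (dyads N) P)"

definition exchangeable :: "'a set \<Rightarrow> ('a set \<Rightarrow> bool) pmf \<Rightarrow> bool" where
  "exchangeable N P \<longleftrightarrow>
     (\<forall>\<pi>. \<pi> permutes N \<longrightarrow> map_pmf (\<lambda>x. \<lambda>d\<in>dyads N. x (\<pi> ` d)) P = P)"

definition network_marginal :: "'a set \<Rightarrow> ('a set \<Rightarrow> bool) pmf \<Rightarrow> ('a set \<Rightarrow> bool) pmf" where
  "network_marginal N P = map_pmf (\<lambda>x. restrict x (dyads N)) P"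

definition strongly_consistent ::
    "'a set \<Rightarrow> ('a set \<Rightarrow> ('a set \<Rightarrow> bool) pmf set) \<Rightarrow> bool" where
  "strongly_consistent N \<P> \<longleftrightarrow>
     (\<forall>N' N''. N'' \<subseteq> N' \<and> N' \<subseteq> N \<and> finite N' \<longrightarrow> \<P> N'' = network_marginal N'' ` \<P> N')"

(* Bidirected edges are rendered as pairs of opposite arcs; there are no loops,
   since a dyad is nonempty and hence not disjoint from itself. *)
definition bidirected_co_incidence_graph :: "'a set \<Rightarrow> 'a set pair_pre_digraph" where
  "bidirected_co_incidence_graph N =
     \<lparr> pverts = dyads N, parcs = {(d, e). d \<in> dyads N \<and> e \<in> dyads N \<and> d \<inter> e = {}} \<rparr>"

(* X_A and X_B are independent under the conditional distribution given X_S = s,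
   for every value s of X_S that has positive probability. *)
definition cond_indep :: "('v \<Rightarrow> bool) pmf \<Rightarrow> 'v set \<Rightarrow> 'v set \<Rightarrow> 'v set \<Rightarrow> bool" where
  "cond_indep P A B S \<longleftrightarrow>
     (\<forall>s. measure_pmf.prob P {x. restrict x S = s} > 0 \<longrightarrow>
        prob_space.indep_var (measure_pmf (cond_pmf P {x. restrict x S = s}))
          (count_space UNIV) (\<lambda>x. restrict x A) (count_space UNIV) (\<lambda>x. restrict x B))"

definition bidirected_Markov :: "'v pair_pre_digraph \<Rightarrow> ('v \<Rightarrow> bool) pmf \<Rightarrow> bool" where
  "bidirected_Markov G P \<longleftrightarrow>
     (\<forall>A B S. A \<subseteq> pverts G \<and> B \<subseteq> pverts G \<and> S \<subseteq> pverts G \<and>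
        A \<inter> B = {} \<and> A \<inter> S = {} \<and> B \<inter> S = {} \<and> A \<noteq> {} \<and> B \<noteq> {} \<and>
        (\<forall>p. vpath p (with_proj G) \<and> hd p \<in> A \<and> last p \<in> B \<longrightarrow> \<not> set p \<subseteq> A \<union> B \<union> S) \<longrightarrow>
        cond_indep P A B S)"

definition erdos_renyi :: "'a set \<Rightarrow> ('a set \<Rightarrow> bool) pmf \<Rightarrow> bool" where
  "erdos_renyi N P \<longleftrightarrow>
     prob_space.indep_vars (measure_pmf P) (\<lambda>_. count_space UNIV) (\<lambda>d x. x d) (dyads N) \<and>
     (\<forall>d\<in>dyads N. \<forall>e\<in>dyads N. map_pmf (\<lambda>x. x d) P = map_pmf (\<lambda>x. x e) P)"

end

theory Submission
  imports Defs
begin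

text \<open>
  Let \<open>p\<close> be the common tie probability and \<open>Y\<^sub>d = X\<^sub>d - p\<close>. Since ties are Boolean, they are
  independent as soon as every centred moment \<open>E (\<Prod>d\<in>F. Y\<^sub>d)\<close> over a nonempty set \<open>F\<close> of dyads
  vanishes (\<open>indep_vars_if_centred_moments_zero\<close>). The Markov property with empty conditioning
  set says that two disjoint sets of dyads are independent if every dyad of the first meets every
  dyad of the second.

  The infinite node set enters through replication
  (\<open>centred_moment_vanishes_by_replication\<close>). Write \<open>F\<close> as the star of its dyads \<open>vt\<close>, \<open>t \<in> T\<close>,
  at a node \<open>v\<close>, together with a set \<open>B\<close> of dyads avoiding \<open>v\<close>. By strong consistency the network
  extends to arbitrarily many fresh nodes, and by exchangeability replacing \<open>v\<close> by a fresh node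
  \<open>k\<close> does not change the moment \<open>c\<close>. Let \<open>Z\<^sub>k\<close> be the product of \<open>Y\<close> over the star at \<open>k\<close> and \<open>W\<close>
  the product over \<open>B\<close>. If distinct \<open>Z\<^sub>k\<close> are orthogonal, then the bounded \<open>W\<close> has the same inner
  product \<open>c\<close> with arbitrarily many bounded orthogonal variables, which forces \<open>c = 0\<close>. So the
  moment of \<open>F\<close> vanishes whenever the moment of two stars with distinct fresh centres and the same
  leaves \<open>T\<close> does.

  This reduction, applied three times, ends at pairs of incident dyads:
  \<^item> Any nonempty \<open>F\<close> reduces to two stars with centres \<open>k, l\<close> and common leaves.
  \<^item> Two such stars, replicated at a leaf, reduce to the four-cycle on \<open>{i, j}\<close> and \<open>{k, l}\<close>.
  \<^item> In a four-cycle each dyad of the perfect matching \<open>ik, jl\<close> meets each dyad of the perfect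
    matching \<open>il, jk\<close>, so the Markov property factors the moment into those of two matchings.
  \<^item> A matching \<open>uv, wz\<close>, replicated at \<open>u\<close>, reduces to two dyads \<open>kv, lv\<close>, which are independent
    by the Markov property.

  The step through the four-cycle is the finite form of the fact that a graphon whose edge density
  is \<open>p\<close> and whose four-cycle density is \<open>p\<^sup>4\<close> is constant.
\<close>

section \<open>Centred moments\<close>

definition centred_prod :: "real \<Rightarrow> 'v set \<Rightarrow> ('v \<Rightarrow> bool) \<Rightarrow> real" where
  "centred_prod p F x = (\<Prod>d\<in>F. of_bool (x d) - p)"

definition centred_moment :: "('v \<Rightarrow> bool) pmf \<Rightarrow> real \<Rightarrow> 'v set \<Rightarrow> real" where
  "centred_moment P p F = measure_pmf.expectation P (centred_prod p F)"

lemma integrable_pmf_bounded: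
  fixes f :: "'x \<Rightarrow> real"
  assumes "\<And>x. \<bar>f x\<bar> \<le> B"
  shows "integrable (measure_pmf P) f"
  by (rule measure_pmf.integrable_const_bound[where B = B]) (use assms in auto)

lemma abs_mult_le_one:
  fixes a b :: real
  assumes "\<bar>a\<bar> \<le> 1" "\<bar>b\<bar> \<le> 1"
  shows "\<bar>a * b\<bar> \<le> 1"
  using mult_mono[OF assms] by (simp add: abs_mult)

lemma abs_centred_prod_le_one:
  assumes "0 \<le> p" "p \<le> 1"
  shows "\<bar>centred_prod p F x\<bar> \<le> 1"
  unfolding centred_prod_def abs_prod
  by (rule prod_le_1) (use assms in \<open>auto simp: of_bool_def\<close>)

lemma centred_prod_Un:
  assumes "finite A" "finite B" "A \<inter> B = {}"
  shows "centred_prod p (A \<union> B) x = centred_prod p A x * centred_prod p B x"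
  using assms by (simp add: centred_prod_def prod.union_disjoint)

lemma centred_moment_Un:
  assumes "finite A" "finite B" "A \<inter> B = {}"
  shows "centred_moment P p (A \<union> B) =
    measure_pmf.expectation P (\<lambda>x. centred_prod p A x * centred_prod p B x)"
  unfolding centred_moment_def
  by (rule arg_cong[where f = "measure_pmf.expectation P"]) (use assms centred_prod_Un in fast)

lemma centred_prod_cong:
  "(\<And>d. d \<in> F \<Longrightarrow> x d = y d) \<Longrightarrow> centred_prod p F x = centred_prod p F y"
  by (simp add: centred_prod_def)

lemma expectation_of_bool:
  "measure_pmf.expectation P (\<lambda>x. of_bool (x d)) = measure_pmf.prob P {x. x d}"
proof -
  have "measure_pmf.expectation P (\<lambda>x. of_bool (x d) :: real) = measure_pmf.expectation P (indicator {x. x d})"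
    by (rule Bochner_Integration.integral_cong) (auto simp: indicator_def)
  then show ?thesis by simp
qed

lemma centred_moment_singleton:
  assumes "measure_pmf.prob P {x. x d} = p"
  shows "centred_moment P p {d} = 0"
proof -
  have "centred_moment P p {d} = measure_pmf.expectation P (\<lambda>x. of_bool (x d)) - p"
    unfolding centred_moment_def centred_prod_def
    by (simp, subst Bochner_Integration.integral_diff)
       (auto intro: integrable_pmf_bounded[where B = 1])
  then show ?thesis using assms by (simp add: expectation_of_bool)
qed

text \<open>
  A quantitative form of Bessel's inequality: in a Hilbert space, a vector of norm at most one cannot
  have the same nonzero inner product with arbitrarily many orthogonal vectors of norm at most one.
\<close>

lemma equicorrelated_orthogonal_bound:
  fixes Z :: "'k \<Rightarrow> 'x \<Rightarrow> real" and W :: "'x \<Rightarrow> real"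
  assumes "finite K"
    and Z: "\<And>k x. k \<in> K \<Longrightarrow> \<bar>Z k x\<bar> \<le> 1" and W: "\<And>x. \<bar>W x\<bar> \<le> 1"
    and corr: "\<And>k. k \<in> K \<Longrightarrow> measure_pmf.expectation P (\<lambda>x. Z k x * W x) = c"
    and orth: "\<And>k l. k \<in> K \<Longrightarrow> l \<in> K \<Longrightarrow> k \<noteq> l \<Longrightarrow>
                 measure_pmf.expectation P (\<lambda>x. Z k x * Z l x) = 0"
  shows "real (card K) * c\<^sup>2 \<le> 1"
proof -
  let ?E = "measure_pmf.expectation P"
  define n where "n = real (card K)"
  \<comment> \<open>The square of \<open>S - t W\<close> has nonnegative expectation; this \<open>t\<close> minimises the resulting bound
      \<open>n - 2 t n c + t\<^sup>2\<close>.\<close>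
  define t where "t = n * c"
  define S where "S x = (\<Sum>k\<in>K. Z k x)" for x
  have le1: "?E f \<le> 1" if "\<And>x. \<bar>f x\<bar> \<le> 1" for f :: "'x \<Rightarrow> real"
  proof -
    have "?E f \<le> ?E (\<lambda>_. 1)"
      by (rule integral_mono[OF integrable_pmf_bounded[where B = 1]])
         (use that abs_le_iff in \<open>auto intro: order_trans[OF abs_ge_self]\<close>)
    then show ?thesis by simp
  qed
  have int_ZZ: "integrable P (\<lambda>x. Z k x * Z l x)" if "k \<in> K" "l \<in> K" for k l
    by (rule integrable_pmf_bounded[where B = 1]) (use that Z abs_mult_le_one in blast)
  have int_ZW: "integrable P (\<lambda>x. Z k x * W x)" if "k \<in> K" for k
    by (rule integrable_pmf_bounded[where B = 1]) (use that Z W abs_mult_le_one in blast)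
  have int_WW: "integrable P (\<lambda>x. W x * W x)"
    by (rule integrable_pmf_bounded[where B = 1]) (use W abs_mult_le_one in blast)
  have SS: "S x * S x = (\<Sum>k\<in>K. \<Sum>l\<in>K. Z k x * Z l x)" for x
    by (simp add: S_def sum_product)
  have SW: "S x * W x = (\<Sum>k\<in>K. Z k x * W x)" for x
    by (simp add: S_def sum_distrib_right)
  have int_SS: "integrable P (\<lambda>x. S x * S x)"
    unfolding SS by (intro Bochner_Integration.integrable_sum int_ZZ)
  have int_SW: "integrable P (\<lambda>x. S x * W x)"
    unfolding SW by (intro Bochner_Integration.integrable_sum int_ZW)
  have E_SW: "?E (\<lambda>x. S x * W x) = n * c"
    unfolding SW by (subst Bochner_Integration.integral_sum) (auto simp: int_ZW corr n_def)
  have "?E (\<lambda>x. S x * S x) = (\<Sum>k\<in>K. \<Sum>l\<in>K. ?E (\<lambda>x. Z k x * Z l x))"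
    unfolding SS
    by (subst Bochner_Integration.integral_sum; (intro Bochner_Integration.integrable_sum int_ZZ)?)
       (auto intro!: sum.cong Bochner_Integration.integral_sum int_ZZ)
  also have "\<dots> = (\<Sum>k\<in>K. \<Sum>l\<in>K. if l = k then ?E (\<lambda>x. Z k x * Z k x) else 0)"
    by (intro sum.cong) (auto simp: orth)
  also have "\<dots> = (\<Sum>k\<in>K. ?E (\<lambda>x. Z k x * Z k x))"
    using \<open>finite K\<close> by (intro sum.cong) auto
  also have "\<dots> \<le> (\<Sum>k\<in>K. 1)"
    by (intro sum_mono le1 abs_mult_le_one Z)
  finally have E_SS: "?E (\<lambda>x. S x * S x) \<le> n" by (simp add: n_def)
  have E_WW: "?E (\<lambda>x. W x * W x) \<le> 1"
    by (intro le1 abs_mult_le_one W)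
  have "0 \<le> ?E (\<lambda>x. (S x - t * W x)\<^sup>2)"
    by (rule Bochner_Integration.integral_nonneg) simp
  also have "(\<lambda>x. (S x - t * W x)\<^sup>2) =
      (\<lambda>x. S x * S x - 2 * t * (S x * W x) + t\<^sup>2 * (W x * W x))"
    by (simp add: fun_eq_iff power2_eq_square algebra_simps)
  also have "?E \<dots> = ?E (\<lambda>x. S x * S x) - 2 * t * ?E (\<lambda>x. S x * W x) + t\<^sup>2 * ?E (\<lambda>x. W x * W x)"
    using int_SS int_SW int_WW by simp
  also have "\<dots> \<le> n - 2 * t * (n * c) + t\<^sup>2 * 1"
    using E_SS mult_left_mono[OF E_WW zero_le_power2[of t]] unfolding E_SW by linarith
  also have "\<dots> = n * (1 - n * c\<^sup>2)"
    by (simp add: t_def power2_eq_square algebra_simps)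
  finally have "0 \<le> n * (1 - n * c\<^sup>2)" .
  then show ?thesis
    by (cases "n = 0") (auto simp: n_def zero_le_mult_iff)
qed

text \<open>
  Every function of a Boolean variable is affine in the centred variable, with its mean as constant
  term. Expanding the product of such functions over finitely many indices gives a combination of centred moments,
  of which only that of the empty set survives; its coefficient is the product of the means.
\<close>

lemma indep_vars_if_centred_moments_zero:
  fixes P :: "('v \<Rightarrow> bool) pmf"
  assumes p: "0 \<le> p" "p \<le> 1"
    and vanish: "\<And>F. finite F \<Longrightarrow> F \<subseteq> V \<Longrightarrow> F \<noteq> {} \<Longrightarrow> centred_moment P p F = 0"
  shows "prob_space.indep_vars (measure_pmf P) (\<lambda>_. count_space UNIV) (\<lambda>d x. x d) V"
proof -
  note P = measure_pmf.prob_space_axioms[of P]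
  let ?E = "measure_pmf.expectation P"
  have product: "measure_pmf.prob P {x. \<forall>d\<in>J. x d \<in> A d} = (\<Prod>d\<in>J. measure_pmf.prob P {x. x d \<in> A d})"
    if J: "J \<subseteq> V" "finite J" for J and A :: "'v \<Rightarrow> bool set"
  proof -
    define b where "b d = (of_bool (True \<in> A d) - of_bool (False \<in> A d) :: real)" for d
    define a where "a d = of_bool (False \<in> A d) + p * b d" for d
    have affine: "of_bool (x d \<in> A d) = b d * (of_bool (x d) - p) + a d" for x d
      by (cases "x d") (auto simp: a_def b_def algebra_simps)
    have prob: "measure_pmf.prob P {x. \<forall>d\<in>I. x d \<in> A d} = (\<Prod>d\<in>I. a d)" if I: "I \<subseteq> J" for I
    proof -
      have fin: "finite I" using I J finite_subset by auto
      have expand: "indicator {x. \<forall>d\<in>I. x d \<in> A d} x =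
          (\<Sum>F\<in>Pow I. (prod b F * prod a (I - F)) * centred_prod p F x)" for x
      proof -
        have "indicator {x. \<forall>d\<in>I. x d \<in> A d} x = (\<Prod>d\<in>I. of_bool (x d \<in> A d) :: real)"
        proof (cases "\<forall>d\<in>I. x d \<in> A d")
          case False
          then show ?thesis using fin by (auto simp: prod_zero_iff)
        qed simp
        also have "\<dots> = (\<Prod>d\<in>I. b d * (of_bool (x d) - p) + a d)"
          by (simp only: affine)
        also have "\<dots> = (\<Sum>F\<in>Pow I. (\<Prod>d\<in>F. b d * (of_bool (x d) - p)) * prod a (I - F))"
          by (rule prod_add[OF fin])
        also have "\<dots> = (\<Sum>F\<in>Pow I. (prod b F * prod a (I - F)) * centred_prod p F x)"
          by (simp add: prod.distrib centred_prod_def mult_ac)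
        finally show ?thesis .
      qed
      have "measure_pmf.prob P {x. \<forall>d\<in>I. x d \<in> A d} = ?E (indicator {x. \<forall>d\<in>I. x d \<in> A d})"
        by simp
      also have "\<dots> = ?E (\<lambda>x. \<Sum>F\<in>Pow I. (prod b F * prod a (I - F)) * centred_prod p F x)"
        by (rule Bochner_Integration.integral_cong) (simp_all add: expand)
      also have "\<dots> = (\<Sum>F\<in>Pow I. (prod b F * prod a (I - F)) * centred_moment P p F)"
        unfolding centred_moment_def
        by (subst Bochner_Integration.integral_sum)
           (auto intro!: integrable_mult_right integrable_pmf_bounded abs_centred_prod_le_one p)
      also have "\<dots> = (\<Sum>F\<in>Pow I. if F = {} then prod a I else 0)"
      proof (rule sum.cong[OF refl])
        fix F assume F: "F \<in> Pow I"
        show "(prod b F * prod a (I - F)) * centred_moment P p F = (if F = {} then prod a I else 0)"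
        proof (cases "F = {}")
          case True
          have "centred_prod p ({} :: 'v set) = (\<lambda>_. 1)" by (simp add: fun_eq_iff centred_prod_def)
          then show ?thesis using True by (simp add: centred_moment_def)
        next
          case False
          then have "centred_moment P p F = 0"
            using F I J fin by (intro vanish) (auto intro: finite_subset)
          then show ?thesis using False by simp
        qed
      qed
      also have "\<dots> = prod a I" using fin by simp
      finally show ?thesis .
    qed
    have "(\<Prod>d\<in>J. measure_pmf.prob P {x. x d \<in> A d}) = (\<Prod>d\<in>J. a d)"
      using prob[of "{_}"] by (intro prod.cong) auto
    then show ?thesis using prob[of J] by simp
  qed
  show ?thesis
    unfolding prob_space.indep_vars_def2[OF P]
  proof (intro conjI ballI prob_space.indep_setsI[OF P])
    fix A and J assume J: "J \<noteq> {}" "J \<subseteq> V" "finite J"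
      and "\<forall>j\<in>J. A j \<in> {(\<lambda>x. x j) -` B \<inter> space (measure_pmf P) |B. B \<in> sets (count_space UNIV)}"
    then have "\<forall>j\<in>J. \<exists>B. A j = {x. x j \<in> B}" by fastforce
    then obtain B where B: "\<And>j. j \<in> J \<Longrightarrow> A j = {x. x j \<in> B j}" by metis
    have "(\<Inter>j\<in>J. A j) = {x. \<forall>j\<in>J. x j \<in> B j}" using B by auto
    then show "measure_pmf.prob P (\<Inter>j\<in>J. A j) = (\<Prod>j\<in>J. measure_pmf.prob P (A j))"
      using product[OF J(2,3), of B] B by simp
  qed auto
qed

section \<open>Consequences of exchangeability and the Markov property\<close>

lemma finite_dyads: "finite M \<Longrightarrow> finite (dyads M)"
  unfolding dyads_def by (rule finite_subset[of _ "Pow M"]) auto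

lemma dyads_mono: "M \<subseteq> M' \<Longrightarrow> dyads M \<subseteq> dyads M'"
  unfolding dyads_def by auto

lemma insert2_in_dyads_iff: "{u, v} \<in> dyads M \<longleftrightarrow> u \<in> M \<and> v \<in> M \<and> u \<noteq> v"
  by (auto simp: dyads_def card_insert_if)

lemma dyads_cases:
  assumes "d \<in> dyads M"
  obtains u v where "d = {u, v}" "u \<in> M" "v \<in> M" "u \<noteq> v"
  using assms by (auto simp: dyads_def card_2_iff)

lemma centred_moment_permute:
  assumes ex: "exchangeable M Q" and \<pi>: "\<pi> permutes M" and F: "F \<subseteq> dyads M"
  shows "centred_moment Q p ((`) \<pi> ` F) = centred_moment Q p F"
proof -
  have "inj \<pi>" using \<pi> permutes_inj by blast
  then have inj: "inj_on ((`) \<pi>) F" by (meson inj_image_eq_iff inj_onI)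
  have "centred_moment Q p F = centred_moment (map_pmf (\<lambda>x. \<lambda>d\<in>dyads M. x (\<pi> ` d)) Q) p F"
    using ex \<pi> unfolding exchangeable_def by simp
  also have "\<dots> = measure_pmf.expectation Q (\<lambda>x. centred_prod p F (\<lambda>d\<in>dyads M. x (\<pi> ` d)))"
    by (simp add: centred_moment_def)
  also have "(\<lambda>x. centred_prod p F (\<lambda>d\<in>dyads M. x (\<pi> ` d))) = centred_prod p ((`) \<pi> ` F)"
    using F by (auto simp: fun_eq_iff centred_prod_def prod.reindex[OF inj] subset_iff intro!: prod.cong)
  finally show ?thesis by (simp add: centred_moment_def)
qed

lemma centred_moment_marginal:
  assumes "F \<subseteq> dyads M"
  shows "centred_moment (network_marginal M Q) p F = centred_moment Q p F"
proof -
  have "centred_prod p F (restrict x (dyads M)) = centred_prod p F x" for x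
    using assms by (intro centred_prod_cong) auto
  then show ?thesis by (simp add: centred_moment_def network_marginal_def)
qed

text \<open>
  The symmetric group acts transitively on the dyads.
\<close>

lemma exchangeable_same_marginal:
  assumes ex: "exchangeable M Q" and "finite M" and d: "d \<in> dyads M" and e: "e \<in> dyads M"
  shows "map_pmf (\<lambda>x. x d) Q = map_pmf (\<lambda>x. x e) Q"
proof -
  have sub: "d \<subseteq> M" "e \<subseteq> M" and card: "card d = 2" "card e = 2"
    using d e by (auto simp: dyads_def)
  have fin: "finite d" "finite e" using sub \<open>finite M\<close> finite_subset by auto
  obtain f where f: "bij_betw f d e"
    using finite_same_card_bij[OF fin] card by auto
  obtain g where g: "bij_betw g (M - d) (M - e)"
    using finite_same_card_bij[of "M - d" "M - e"] \<open>finite M\<close> sub fin card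
    by (auto simp: card_Diff_subset)
  define \<pi> where "\<pi> v = (if v \<in> d then f v else if v \<in> M then g v else v)" for v
  have "bij_betw \<pi> d e" using f by (rule bij_betw_cong[THEN iffD1, rotated]) (simp add: \<pi>_def)
  moreover have "bij_betw \<pi> (M - d) (M - e)"
    using g by (rule bij_betw_cong[THEN iffD1, rotated]) (simp add: \<pi>_def)
  ultimately have "bij_betw \<pi> (d \<union> (M - d)) (e \<union> (M - e))"
    by (rule bij_betw_combine) auto
  moreover have "d \<union> (M - d) = M" "e \<union> (M - e) = M" using sub by auto
  ultimately have "\<pi> permutes M"
    using sub by (intro bij_imp_permutes) (auto simp: \<pi>_def)
  then have "map_pmf (\<lambda>x. x d) Q = map_pmf (\<lambda>x. x d) (map_pmf (\<lambda>x. \<lambda>d\<in>dyads M. x (\<pi> ` d)) Q)"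
    using ex unfolding exchangeable_def by simp
  also have "\<dots> = map_pmf (\<lambda>x. x (\<pi> ` d)) Q"
    using d by (simp add: pmf.map_comp comp_def)
  also have "\<pi> ` d = e" using \<open>bij_betw \<pi> d e\<close> by (simp add: bij_betw_def)
  finally show ?thesis .
qed

lemma prob_eq_map_pmf: "measure_pmf.prob Q {x. x d} = pmf (map_pmf (\<lambda>x. x d) Q) True"
  by (simp add: pmf_map vimage_def)

lemma vwalk_stays_in:
  assumes "set (vwalk_arcs q) \<subseteq> R" "q \<noteq> []" "hd q \<in> A"
    and "\<And>u v. (u, v) \<in> R \<Longrightarrow> u \<in> A \<Longrightarrow> v \<in> set q \<Longrightarrow> v \<in> A"
  shows "last q \<in> A"
  using assms by (induction q rule: vwalk_arcs.induct) auto

text \<open>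
  A bidirected edge joins disjoint dyads only. If each dyad of \<open>A\<close> meets each dyad of \<open>B\<close>, a path
  that stays within \<open>A \<union> B\<close> can therefore never leave \<open>A\<close>, and the Markov property applies with
  empty conditioning set.
\<close>

lemma centred_moment_Un_Markov:
  assumes p: "0 \<le> p" "p \<le> 1" and fin: "finite A" "finite B"
    and Markov: "bidirected_Markov (bidirected_co_incidence_graph M) Q"
    and sub: "A \<subseteq> dyads M" "B \<subseteq> dyads M" and ne: "A \<noteq> {}" "B \<noteq> {}" and disj: "A \<inter> B = {}"
    and meet: "\<And>a b. a \<in> A \<Longrightarrow> b \<in> B \<Longrightarrow> a \<inter> b \<noteq> {}"
  shows "centred_moment Q p (A \<union> B) = centred_moment Q p A * centred_moment Q p B"
proof -
  note Q = measure_pmf.prob_space_axioms[of Q]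
  let ?G = "bidirected_co_incidence_graph M"
  have sep: "\<not> set q \<subseteq> A \<union> B \<union> {}"
    if "vpath q (with_proj ?G) \<and> hd q \<in> A \<and> last q \<in> B" for q
  proof
    assume q: "set q \<subseteq> A \<union> B \<union> {}"
    have "last q \<in> A"
    proof (rule vwalk_stays_in[of q "parcs ?G"])
      fix u v assume "(u, v) \<in> parcs ?G" "u \<in> A" "v \<in> set q"
      then show "v \<in> A" using q meet[of u v] by (auto simp: bidirected_co_incidence_graph_def)
    qed (use that in \<open>auto simp: vpath_def vwalk_def\<close>)
    then show False using that disj by auto
  qed
  have "cond_indep Q A B {}"
    by (rule Markov[unfolded bidirected_Markov_def, rule_format])
       (use sep sub ne disj in \<open>simp add: bidirected_co_incidence_graph_def\<close>)
  \<comment> \<open>The empty family has a single value, so that conditioning on it changes nothing.\<close>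
  moreover have all: "{x. restrict x {} = (\<lambda>_. undefined :: bool)} = (UNIV :: ('a set \<Rightarrow> bool) set)"
    by (auto simp: restrict_def)
  ultimately have "prob_space.indep_var (measure_pmf (cond_pmf Q UNIV))
      (count_space UNIV) (\<lambda>x. restrict x A) (count_space UNIV) (\<lambda>x. restrict x B)"
    unfolding cond_indep_def by (elim allE[where x = "\<lambda>_. undefined"]) simp
  also have "cond_pmf Q UNIV = Q"
    by (rule pmf_eqI) (simp add: pmf_cond set_pmf_not_empty)
  finally have "prob_space.indep_var (measure_pmf Q)
      (count_space UNIV) (\<lambda>x. restrict x A) (count_space UNIV) (\<lambda>x. restrict x B)" .
  then have "prob_space.indep_var (measure_pmf Q) borel (centred_prod p A \<circ> (\<lambda>x. restrict x A))
      borel (centred_prod p B \<circ> (\<lambda>x. restrict x B))"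
    by (rule prob_space.indep_var_compose[OF Q]) auto
  moreover have "centred_prod p C \<circ> (\<lambda>x. restrict x C) = centred_prod p C" for C :: "'a set set"
    by (auto simp: fun_eq_iff intro!: centred_prod_cong)
  ultimately have indep: "prob_space.indep_var (measure_pmf Q) borel (centred_prod p A) borel (centred_prod p B)"
    by simp
  show ?thesis
    unfolding centred_moment_Un[OF fin disj]
    unfolding centred_moment_def
    by (rule prob_space.indep_var_lebesgue_integral[OF Q indep])
       (auto intro: integrable_pmf_bounded abs_centred_prod_le_one p)
qed

section \<open>Vanishing of the centred moments\<close>

definition star :: "'a \<Rightarrow> 'a set \<Rightarrow> 'a set set" where
  "star v T = (\<lambda>t. {v, t}) ` T"

lemma star_in_dyads: "v \<in> M \<Longrightarrow> T \<subseteq> M - {v} \<Longrightarrow> star v T \<subseteq> dyads M"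
  by (auto simp: star_def insert2_in_dyads_iff)

lemma transpose_star:
  assumes "v \<notin> T" "w \<notin> T"
  shows "(`) (Transposition.transpose v w) ` star v T = star w T"
proof -
  have "Transposition.transpose v w ` {v, t} = {w, t}" if "t \<in> T" for t
    using that assms by (auto simp: Transposition.transpose_def)
  then show ?thesis by (simp add: star_def image_image)
qed

lemma transpose_fresh:
  assumes "\<And>d. d \<in> B \<Longrightarrow> v \<notin> d \<and> w \<notin> d"
  shows "(`) (Transposition.transpose v w) ` B = B"
proof -
  have "Transposition.transpose v w ` d = d" if "d \<in> B" for d
    using assms[OF that] by (force simp: Transposition.transpose_def image_iff)
  then show ?thesis by simp
qed

text \<open>
  Replication passes from one network to all its finite extensions, so the lemmas below concern the
  whole consistent family rather than a single distribution.
\<close>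

locale exchangeable_Markov_networks =
  fixes N :: "'a set" and \<P> :: "'a set \<Rightarrow> ('a set \<Rightarrow> bool) pmf set"
  assumes infinite_nodes: "infinite N"
    and consistent: "strongly_consistent N \<P>"
    and exch: "M \<subseteq> N \<Longrightarrow> finite M \<Longrightarrow> Q \<in> \<P> M \<Longrightarrow> exchangeable M Q"
    and Markov: "M \<subseteq> N \<Longrightarrow> finite M \<Longrightarrow> Q \<in> \<P> M \<Longrightarrow>
                   bidirected_Markov (bidirected_co_incidence_graph M) Q"
begin

text \<open>
  The centring constant \<open>p\<close> is a parameter, rather than read off from \<open>Q\<close>, because a network and its
  extensions have to be centred at the same value.
\<close>

definition model_with_density :: "real \<Rightarrow> 'a set \<Rightarrow> ('a set \<Rightarrow> bool) pmf \<Rightarrow> bool" where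
  "model_with_density p M Q \<longleftrightarrow> M \<subseteq> N \<and> finite M \<and> Q \<in> \<P> M \<and> 0 \<le> p \<and> p \<le> 1 \<and>
     (\<forall>d\<in>dyads M. measure_pmf.prob Q {x. x d} = p)"

lemma model_extends:
  assumes mem: "model_with_density p M Q" and "dyads M \<noteq> {}" and M': "M \<subseteq> M'" "M' \<subseteq> N" "finite M'"
  obtains Q' where "model_with_density p M' Q'" "network_marginal M Q' = Q"
proof -
  have "\<P> M = network_marginal M ` \<P> M'"
    using consistent M' unfolding strongly_consistent_def by blast
  then obtain Q' where Q': "Q' \<in> \<P> M'" "network_marginal M Q' = Q"
    using mem unfolding model_with_density_def by auto
  obtain d where d: "d \<in> dyads M" using \<open>dyads M \<noteq> {}\<close> by blast
  then have d': "d \<in> dyads M'" using dyads_mono M' by blast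
  have "p = measure_pmf.prob (network_marginal M Q') {x. x d}"
    using mem d Q' unfolding model_with_density_def by simp
  also have "\<dots> = measure_pmf.prob Q' {x. x d}"
    using d by (simp add: network_marginal_def vimage_def)
  finally have "measure_pmf.prob Q' {x. x d} = p" ..
  then have "measure_pmf.prob Q' {x. x e} = p" if "e \<in> dyads M'" for e
    using exchangeable_same_marginal[OF exch[OF M'(2,3) Q'(1)] M'(3) d' that]
    by (simp add: prob_eq_map_pmf)
  then have "model_with_density p M' Q'" using mem M' Q' unfolding model_with_density_def by blast
  with Q' that show ?thesis by blast
qed

text \<open>
  The nodes \<open>k\<close> added to the network are interchangeable copies of \<open>v\<close>, and \<open>double\<close> is the
  orthogonality of the star products at distinct copies. Any number of copies is available,
  so the bound on equicorrelated orthogonal variables leaves only the value zero.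
\<close>

lemma centred_moment_vanishes_by_replication:
  assumes mem: "model_with_density p M Q"
    and v: "v \<in> M" and T: "T \<subseteq> M - {v}" "T \<noteq> {}" and B: "B \<subseteq> dyads (M - {v})"
    and double: "\<And>M' Q' k l. model_with_density p M' Q' \<Longrightarrow> M \<subseteq> M' \<Longrightarrow> k \<in> M' - M \<Longrightarrow> l \<in> M' - M \<Longrightarrow> k \<noteq> l \<Longrightarrow>
            centred_moment Q' p (star k T \<union> star l T) = 0"
  shows "centred_moment Q p (star v T \<union> B) = 0"
proof -
  define c where "c = centred_moment Q p (star v T \<union> B)"
  have p: "0 \<le> p" "p \<le> 1" and M: "M \<subseteq> N" "finite M" using mem by (auto simp: model_with_density_def)
  have FM: "star v T \<union> B \<subseteq> dyads M"
    using star_in_dyads[OF v T(1)] B dyads_mono[of "M - {v}" M] by auto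
  have ne: "dyads M \<noteq> {}"
    using FM T(2) by (auto simp: star_def)
  have vB: "v \<notin> d" "d \<subseteq> M" if "d \<in> B" for d using that B by (auto simp: dyads_def)
  have finT: "finite T" "finite B"
    using T B M finite_dyads[of "M - {v}"] by (auto intro: finite_subset)
  have bound: "real n * c\<^sup>2 \<le> 1" for n
  proof -
    have "infinite (N - M)" using infinite_nodes M by simp
    then obtain K where K: "K \<subseteq> N - M" "card K = n" "finite K"
      using infinite_arbitrarily_large by metis
    obtain Q' where Q': "model_with_density p (M \<union> K) Q'" and marg: "network_marginal M Q' = Q"
      by (rule model_extends[OF mem ne, of "M \<union> K"]) (use K M in auto)
    have ex: "exchangeable (M \<union> K) Q'" using Q' exch by (auto simp: model_with_density_def)
    have FK: "star v T \<union> B \<subseteq> dyads (M \<union> K)" using FM dyads_mono[of M "M \<union> K"] by auto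
    have "real (card K) * c\<^sup>2 \<le> 1"
    proof (rule equicorrelated_orthogonal_bound[where P = Q'
          and Z = "\<lambda>k. centred_prod p (star k T)" and W = "centred_prod p B"])
      fix k assume k: "k \<in> K"
      have kM: "k \<notin> M" using k K by auto
      have kT: "k \<notin> T" using kM T by auto
      have kB: "k \<notin> d" if "d \<in> B" for d using kM vB that by auto
      have "c = centred_moment Q' p (star v T \<union> B)"
        unfolding c_def marg[symmetric] by (rule centred_moment_marginal[OF FM])
      also have "\<dots> = centred_moment Q' p ((`) (Transposition.transpose v k) ` (star v T \<union> B))"
        using k v by (intro centred_moment_permute[symmetric, OF ex _ FK] permutes_swap_id) auto
      also have "(`) (Transposition.transpose v k) ` (star v T \<union> B) = star k T \<union> B"
        using T kT kB vB unfolding image_Un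
        by (subst transpose_star; (subst transpose_fresh)?) auto
      also have "centred_moment Q' p (star k T \<union> B) =
          measure_pmf.expectation Q' (\<lambda>x. centred_prod p (star k T) x * centred_prod p B x)"
        by (rule centred_moment_Un) (use finT kB in \<open>auto simp: star_def\<close>)
      finally show "measure_pmf.expectation Q' (\<lambda>x. centred_prod p (star k T) x * centred_prod p B x) = c" ..
    next
      fix k l assume kl: "k \<in> K" "l \<in> K" "k \<noteq> l"
      then have "centred_moment Q' p (star k T \<union> star l T) = 0"
        using K by (intro double[OF Q']) auto
      then show "measure_pmf.expectation Q' (\<lambda>x. centred_prod p (star k T) x * centred_prod p (star l T) x) = 0"
        using kl K T finT by (subst (asm) centred_moment_Un) (auto simp: star_def doubleton_eq_iff)
    qed (use K abs_centred_prod_le_one p in auto)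
    then show ?thesis using K by simp
  qed
  have "c = 0"
  proof (rule ccontr)
    assume "c \<noteq> 0"
    then have "c\<^sup>2 > 0" by simp
    then obtain n where "real n * c\<^sup>2 > 1" using reals_Archimedean3 by blast
    with bound[of n] show False by simp
  qed
  then show ?thesis by (simp add: c_def)
qed

lemma centred_moment_Un_model:
  assumes mem: "model_with_density p M Q"
    and AB: "A \<subseteq> dyads M" "B \<subseteq> dyads M" "A \<noteq> {}" "B \<noteq> {}" "A \<inter> B = {}"
    and meet: "\<And>a b. a \<in> A \<Longrightarrow> b \<in> B \<Longrightarrow> a \<inter> b \<noteq> {}"
  shows "centred_moment Q p (A \<union> B) = centred_moment Q p A * centred_moment Q p B"
proof -
  have "0 \<le> p" "p \<le> 1" "bidirected_Markov (bidirected_co_incidence_graph M) Q" "finite (dyads M)"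
    using mem Markov finite_dyads by (auto simp: model_with_density_def)
  then show ?thesis
    using AB meet by (intro centred_moment_Un_Markov) (auto intro: finite_subset)
qed

lemma centred_moment_singleton_vanishes:
  assumes "model_with_density p M Q" "d \<in> dyads M"
  shows "centred_moment Q p {d} = 0"
  by (rule centred_moment_singleton) (use assms in \<open>unfold model_with_density_def, blast\<close>)

text \<open>
  Disjoint dyads are uncorrelated although the Markov property alone allows them to depend on each
  other: copies of \<open>u\<close> yield dyads that share the node \<open>v\<close> and are therefore independent.
\<close>

lemma centred_moment_matching_vanishes:
  assumes mem: "model_with_density p M Q" and nodes: "{u, v, w, z} \<subseteq> M" "distinct [u, v, w, z]"
  shows "centred_moment Q p {{u, v}, {w, z}} = 0"
proof -
  have "centred_moment Q p (star u {v} \<union> {{w, z}}) = 0"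
  proof (rule centred_moment_vanishes_by_replication[OF mem])
    fix M' Q' k l assume M': "model_with_density p M' Q'" "M \<subseteq> M'" "k \<in> M' - M" "l \<in> M' - M" "k \<noteq> l"
    have "centred_moment Q' p ({{k, v}} \<union> {{l, v}}) = centred_moment Q' p {{k, v}} * centred_moment Q' p {{l, v}}"
      using M' nodes by (intro centred_moment_Un_model[of p M'])
        (auto simp: insert2_in_dyads_iff doubleton_eq_iff)
    also have "centred_moment Q' p {{k, v}} = 0"
      using M' nodes by (intro centred_moment_singleton_vanishes[of p M']) (auto simp: insert2_in_dyads_iff)
    finally show "centred_moment Q' p (star k {v} \<union> star l {v}) = 0"
      by (simp add: star_def)
  qed (use nodes in \<open>auto simp: insert2_in_dyads_iff\<close>)
  then show ?thesis by (simp add: star_def insert_commute)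
qed

text \<open>
  A four-cycle splits into its two perfect matchings, and every dyad of one meets every dyad of the
  other.
\<close>

lemma centred_moment_four_cycle_vanishes:
  assumes mem: "model_with_density p M Q" and nodes: "{i, j, k, l} \<subseteq> M" "distinct [i, j, k, l]"
  shows "centred_moment Q p (star i {k, l} \<union> star j {k, l}) = 0"
proof -
  have "star i {k, l} \<union> star j {k, l} = {{i, k}, {j, l}} \<union> {{i, l}, {j, k}}"
    by (auto simp: star_def)
  moreover have "centred_moment Q p ({{i, k}, {j, l}} \<union> {{i, l}, {j, k}}) =
      centred_moment Q p {{i, k}, {j, l}} * centred_moment Q p {{i, l}, {j, k}}"
    using nodes by (intro centred_moment_Un_model[OF mem])
      (auto simp: insert2_in_dyads_iff doubleton_eq_iff)
  moreover have "centred_moment Q p {{i, k}, {j, l}} = 0"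
    using nodes by (intro centred_moment_matching_vanishes[OF mem]) auto
  ultimately show ?thesis by simp
qed

text \<open>
  Copies of a common leaf \<open>t\<close>, each joined to \<open>k\<close> and \<open>l\<close>, form a four-cycle with \<open>k\<close> and \<open>l\<close>.
\<close>

lemma centred_moment_twin_stars_vanishes:
  assumes mem: "model_with_density p M Q" and kl: "k \<in> M" "l \<in> M" "k \<noteq> l"
    and T: "T \<subseteq> M - {k, l}" "T \<noteq> {}"
  shows "centred_moment Q p (star k T \<union> star l T) = 0"
proof -
  obtain t where t: "t \<in> T" using T by blast
  have "centred_moment Q p (star t {k, l} \<union> (star k (T - {t}) \<union> star l (T - {t}))) = 0"
  proof (rule centred_moment_vanishes_by_replication[OF mem])
    show "star k (T - {t}) \<union> star l (T - {t}) \<subseteq> dyads (M - {t})"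
      using kl T t by (auto simp: star_def insert2_in_dyads_iff)
  next
    fix M' Q' i j assume M': "model_with_density p M' Q'" "M \<subseteq> M'" "i \<in> M' - M" "j \<in> M' - M" "i \<noteq> j"
    then show "centred_moment Q' p (star i {k, l} \<union> star j {k, l}) = 0"
      using kl by (intro centred_moment_four_cycle_vanishes[of p M']) auto
  qed (use kl T t in auto)
  also have "star t {k, l} \<union> (star k (T - {t}) \<union> star l (T - {t})) = star k T \<union> star l T"
    using t by (auto simp: star_def insert_commute)
  finally show ?thesis .
qed

text \<open>
  Choosing \<open>v\<close> as an end of some dyad of \<open>F\<close> makes the star at \<open>v\<close> nonempty, which is what two
  stars on its leaves need in order to have a vanishing moment.
\<close>

lemma centred_moment_vanishes:
  assumes mem: "model_with_density p M Q" and F: "F \<subseteq> dyads M" "F \<noteq> {}"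
  shows "centred_moment Q p F = 0"
proof -
  obtain u v where uv: "{v, u} \<in> F" "u \<in> M" "v \<in> M" "u \<noteq> v"
  proof -
    obtain d where "d \<in> F" "d \<in> dyads M" using F by blast
    with that show ?thesis by (auto elim: dyads_cases)
  qed
  define T where "T = {t. {v, t} \<in> F}"
  define B where "B = {d \<in> F. v \<notin> d}"
  have T: "T \<subseteq> M - {v}"
  proof
    fix t assume "t \<in> T"
    then have "{v, t} \<in> dyads M" using F by (auto simp: T_def)
    then show "t \<in> M - {v}" by (auto simp: insert2_in_dyads_iff)
  qed
  have TB: "F = star v T \<union> B"
  proof
    show "F \<subseteq> star v T \<union> B"
    proof
      fix d assume d: "d \<in> F"
      then obtain a b where "d = {a, b}" using F dyads_cases by blast
      then show "d \<in> star v T \<union> B" using d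
        by (auto simp: star_def T_def B_def insert_commute)
    qed
  qed (auto simp: star_def T_def B_def)
  have "centred_moment Q p (star v T \<union> B) = 0"
  proof (rule centred_moment_vanishes_by_replication[OF mem uv(3) T])
    show "T \<noteq> {}" using uv by (auto simp: T_def)
    show "B \<subseteq> dyads (M - {v})" using F by (auto simp: B_def dyads_def)
    fix M' Q' k l assume "model_with_density p M' Q'" "M \<subseteq> M'" "k \<in> M' - M" "l \<in> M' - M" "k \<noteq> l"
    then show "centred_moment Q' p (star k T \<union> star l T) = 0"
      using T \<open>T \<noteq> {}\<close> by (intro centred_moment_twin_stars_vanishes) auto
  qed
  then show ?thesis using TB by simp
qed

lemma erdos_renyi_model:
  assumes M: "M \<subseteq> N" "finite M" and Q: "Q \<in> \<P> M"
  shows "erdos_renyi M Q"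
proof -
  have same: "map_pmf (\<lambda>x. x d) Q = map_pmf (\<lambda>x. x e) Q" if "d \<in> dyads M" "e \<in> dyads M" for d e
    using exchangeable_same_marginal[OF exch[OF M Q] M(2) that] .
  obtain p where "\<forall>d\<in>dyads M. measure_pmf.prob Q {x. x d} = p" "0 \<le> p" "p \<le> 1"
  proof (cases "dyads M = {}")
    case False
    then obtain e where "e \<in> dyads M" by blast
    then have "\<forall>d\<in>dyads M. measure_pmf.prob Q {x. x d} = measure_pmf.prob Q {x. x e}"
      unfolding prob_eq_map_pmf using same by metis
    then show ?thesis by (rule that) simp_all
  qed (use that[of 0] in auto)
  then have mem: "model_with_density p M Q" using M Q by (simp add: model_with_density_def)
  have "prob_space.indep_vars (measure_pmf Q) (\<lambda>_. count_space UNIV) (\<lambda>d x. x d) (dyads M)"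
    by (rule indep_vars_if_centred_moments_zero[where p = p])
       (use mem centred_moment_vanishes[OF mem] in \<open>auto simp: model_with_density_def\<close>)
  then show ?thesis using same unfolding erdos_renyi_def by blast
qed

end

theorem proposition7:
  fixes N :: "'a set" and \<P> :: "'a set \<Rightarrow> ('a set \<Rightarrow> bool) pmf set"
  assumes "countable N" and "infinite N"
    and "\<And>N'. N' \<subseteq> N \<Longrightarrow> finite N' \<Longrightarrow> random_network_model N' (\<P> N')"
    and "strongly_consistent N \<P>"
    and "\<And>N' P. N' \<subseteq> N \<Longrightarrow> finite N' \<Longrightarrow> P \<in> \<P> N' \<Longrightarrow>
           exchangeable N' P \<and> bidirected_Markov (bidirected_co_incidence_graph N') P"
  shows "\<forall>N' P. N' \<subseteq> N \<and> finite N' \<and> P \<in> \<P> N' \<longrightarrow> erdos_renyi N' P"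
proof -
  interpret exchangeable_Markov_networks N \<P>
    by standard (use assms in auto)
  show ?thesis using erdos_renyi_model by blast
qed

end
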